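(* Let $\beta=(\beta_1,\beta_2,\ldots,\beta_s)$ be a composition with $s$ odd, let $F(\beta)$ be the corresponding fence, let $n=\#F(\beta)$, and let $r_0,r_1,\ldots,r_n$ be the rank sequence of the distributive lattice $L(\beta)$ of lower order ideals of $F(\beta)$, i.e. $r_k$ is the number of lower order ideals of $F(\beta)$ with exactly $k$ elements. Then for all $k$ with $0\le k\le\min\{\beta_1,\beta_s\}$ we have $r_k=r_{n-k}$.
   Context: A composition is a finite sequence $\beta=(\beta_1,\ldots,\beta_s)$ of positive integers. The fence $F(\beta)$ is the poset obtained by taking chains $S_1,\ldots,S_s$, where $S_i$ has length $\beta_i$ (i.e. $\beta_i+1$ elements), and identifying the maximal elements of $S_i$ and $S_{i+1}$ for $i$ odd and the minimal elements of $S_i$ and $S_{i+1}$ for $i$ even. Its cover relations are thus $x_1\lessdot x_2\lessdot\cdots\lessdot x_{\beta_1+1}\gtrdot x_{\beta_1+2}\gtrdot\cdots\gtrdot x_{\beta_1+\beta_2+1}\lessdot\cdots$, and $\#F(\beta)=1+\sum_i\beta_i$. Ideals are lower order ideals, ordered by inclusion in $L(\beta)$; the rank of an ideal is its cardinality. *)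

theory Defs
  imports Main
begin

definition composition :: "nat list \<Rightarrow> bool" where
  "composition \<beta> \<longleftrightarrow> (\<forall>b \<in> set \<beta>. 0 < b)"

text \<open>
  The element $x_{v+1}$ of the fence is represented by the natural number $v$. With 0-based
  indices, the segment $S_{i+1}$ consists of the vertices from \<open>seg_start \<beta> i\<close> to
  \<open>seg_start \<beta> (Suc i) = seg_start \<beta> i + \<beta> ! i\<close>, both included; so consecutive segments share one
  vertex. Segments with even \<open>i\<close> (odd in 1-based numbering) ascend from left to right, the
  others descend.
\<close>

definition seg_start :: "nat list \<Rightarrow> nat \<Rightarrow> nat" where
  "seg_start \<beta> i = sum_list (take i \<beta>)"

definition fence :: "nat list \<Rightarrow> nat set" where
  "fence \<beta> = {0..sum_list \<beta>}"

definition fence_cover :: "nat list \<Rightarrow> nat rel" where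
  "fence_cover \<beta> =
     {(seg_start \<beta> i + j, seg_start \<beta> i + j + 1) | i j. i < length \<beta> \<and> j < \<beta> ! i \<and> even i} \<union>
     {(seg_start \<beta> i + j + 1, seg_start \<beta> i + j) | i j. i < length \<beta> \<and> j < \<beta> ! i \<and> odd i}"

definition fence_le :: "nat list \<Rightarrow> nat rel" where
  "fence_le \<beta> = {(x, y). x \<in> fence \<beta> \<and> y \<in> fence \<beta> \<and> (x, y) \<in> (fence_cover \<beta>)\<^sup>*}"

definition fence_ideals :: "nat list \<Rightarrow> nat set set" where
  "fence_ideals \<beta> = {I. I \<subseteq> fence \<beta> \<and> (\<forall>x y. y \<in> I \<longrightarrow> (x, y) \<in> fence_le \<beta> \<longrightarrow> x \<in> I)}"

definition rank_number :: "nat list \<Rightarrow> nat \<Rightarrow> nat" where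
  "rank_number \<beta> k = card {I \<in> fence_ideals \<beta>. card I = k}"

lemma card_fence: "card (fence \<beta>) = 1 + sum_list \<beta>"
  by (simp add: fence_def)

lemma seg_start_Suc: "i < length \<beta> \<Longrightarrow> seg_start \<beta> (Suc i) = seg_start \<beta> i + \<beta> ! i"
  by (simp add: seg_start_def take_Suc_conv_app_nth)

lemma seg_start_mono: "i \<le> i' \<Longrightarrow> seg_start \<beta> i \<le> seg_start \<beta> i'"
proof (induction i' rule: dec_induct)
  case (step m)
  then show ?case
    by (cases "m < length \<beta>") (auto simp: seg_start_Suc, simp add: seg_start_def)
qed simp

lemma seg_unique:
  assumes "i < length \<beta>" "j < \<beta> ! i" "i' < length \<beta>" "j' < \<beta> ! i'"
    and "seg_start \<beta> i + j = seg_start \<beta> i' + j'"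
  shows "i = i'"
proof (rule linorder_cases[of i i'])
  assume "i < i'"
  then have "seg_start \<beta> (Suc i) \<le> seg_start \<beta> i'" by (intro seg_start_mono) simp
  with assms seg_start_Suc[of i \<beta>] show ?thesis by simp
next
  assume "i' < i"
  then have "seg_start \<beta> (Suc i') \<le> seg_start \<beta> i" by (intro seg_start_mono) simp
  with assms seg_start_Suc[of i' \<beta>] show ?thesis by simp
qed

lemma fence_cover_adjacent:
  "(x, y) \<in> fence_cover \<beta> \<Longrightarrow> y = Suc x \<or> x = Suc y"
  by (auto simp: fence_cover_def)

lemma fence_cover_asym:
  assumes "(x, y) \<in> fence_cover \<beta>"
  shows "(y, x) \<notin> fence_cover \<beta>"
proof -
  have up: "\<exists>i j. v = seg_start \<beta> i + j \<and> i < length \<beta> \<and> j < \<beta> ! i \<and> even i"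
    if "(v, Suc v) \<in> fence_cover \<beta>" for v
    using that unfolding fence_cover_def by auto
  have down: "\<exists>i j. v = seg_start \<beta> i + j \<and> i < length \<beta> \<and> j < \<beta> ! i \<and> odd i"
    if "(Suc v, v) \<in> fence_cover \<beta>" for v
    using that unfolding fence_cover_def by auto
  have "\<not> ((v, Suc v) \<in> fence_cover \<beta> \<and> (Suc v, v) \<in> fence_cover \<beta>)" for v
    using up[of v] down[of v] seg_unique by metis
  with fence_cover_adjacent[OF assms] assms show ?thesis by blast
qed

definition fence_height :: "nat list \<Rightarrow> nat \<Rightarrow> int" where
  "fence_height \<beta> v = (\<Sum>j<v. if (j, Suc j) \<in> fence_cover \<beta> then 1 else - 1)"

lemma fence_height_cover:
  assumes "(x, y) \<in> fence_cover \<beta>"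
  shows "fence_height \<beta> y = fence_height \<beta> x + 1"
  using fence_cover_adjacent[OF assms] fence_cover_asym[OF assms] assms
  by (auto simp: fence_height_def)

lemma fence_height_le:
  "(x, y) \<in> (fence_cover \<beta>)\<^sup>* \<Longrightarrow> fence_height \<beta> x < fence_height \<beta> y \<or> x = y"
  by (induction rule: rtrancl_induct) (auto dest: fence_height_cover)

lemma fence_partial_order: "partial_order_on (fence \<beta>) (fence_le \<beta>)"
proof -
  have "antisym (fence_le \<beta>)"
    by (rule antisymI) (auto simp: fence_le_def dest!: fence_height_le)
  then show ?thesis
    by (auto simp: partial_order_on_def preorder_on_def refl_on_def trans_def fence_le_def)
qed

lemma fence_cover_in_fence:
  assumes "(x, y) \<in> fence_cover \<beta>"
  shows "x \<in> fence \<beta> \<and> y \<in> fence \<beta>"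
proof -
  have "seg_start \<beta> i + j + 1 \<le> sum_list \<beta>" if "i < length \<beta>" "j < \<beta> ! i" for i j
    using seg_start_Suc[of i \<beta>] seg_start_mono[of "Suc i" "length \<beta>" \<beta>] that
    by (simp add: seg_start_def)
  moreover obtain i j where "i < length \<beta>" "j < \<beta> ! i"
      "x \<le> seg_start \<beta> i + j + 1" "y \<le> seg_start \<beta> i + j + 1"
    using assms unfolding fence_cover_def by fastforce
  ultimately show ?thesis
    unfolding fence_def by (meson atLeastAtMost_iff le0 le_trans)
qed

lemma fence_cover_iff:
  "(x, y) \<in> fence_cover \<beta> \<longleftrightarrow>
     (x, y) \<in> fence_le \<beta> \<and> x \<noteq> y \<and>
     (\<forall>z. (x, z) \<in> fence_le \<beta> \<longrightarrow> (z, y) \<in> fence_le \<beta> \<longrightarrow> z = x \<or> z = y)"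
  (is "?l \<longleftrightarrow> ?r")
proof
  assume c: ?l
  note h = fence_height_cover[OF c]
  have "z = x \<or> z = y" if "(x, z) \<in> fence_le \<beta>" "(z, y) \<in> fence_le \<beta>" for z
    using fence_height_le[of x z \<beta>] fence_height_le[of z y \<beta>] h that
    by (auto simp: fence_le_def)
  with c h fence_cover_in_fence[OF c] show ?r
    by (auto simp: fence_le_def)
next
  assume r: ?r
  then have "(x, y) \<in> (fence_cover \<beta>)\<^sup>*" "x \<noteq> y" by (auto simp: fence_le_def)
  then obtain z where z: "(x, z) \<in> fence_cover \<beta>" "(z, y) \<in> (fence_cover \<beta>)\<^sup>*"
    by (meson converse_rtranclE)
  with r fence_cover_in_fence[OF z(1)] have "z = x \<or> z = y"
    by (auto simp: fence_le_def)
  moreover have "z \<noteq> x" using fence_height_cover[OF z(1)] by auto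
  ultimately show ?l using z(1) by simp
qed

end

theory Submission
  imports Defs "HOL-Computational_Algebra.Polynomial"
begin

text \<open>
  Close the fence up to a circle by adding the relation $x_1 < x_n$. An ideal with at most
  $\beta_s$ elements cannot contain $x_n$, and an ideal missing at most $\beta_1$ elements must
  contain $x_1$, so in the relevant ranks the ideals of the fence and of the circle coincide. The
  circle is rank symmetric: the rank generating function of its ideals is the trace of a product
  of $2\times 2$ transfer matrices, for weight $1$ on absent and $q$ on present elements:
  $A = [[1,0],[q,q]]$ for ascending and $B = [[1,1],[0,q]]$ for descending edges (lists of rows).
  Counting complements by size instead replaces them by $A' = [[q,0],[1,1]]$ and
  $B' = [[q,q],[0,1]]$. The matrix $P = [[q,q-1],[1-q,1]]$, of determinant $q^2-q+1 \neq 0$,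
  satisfies $PA = A'P$ and $PB = B'P$, so the two traces agree.
\<close>

section \<open>Transfer matrices for zigzags\<close>

text \<open>Edge directions are an arbitrary function instead of coming from a composition, so that
  induction can add one edge at a time.\<close>

definition zigzag_ideals :: "(nat \<Rightarrow> bool) \<Rightarrow> nat \<Rightarrow> nat set set" where
  "zigzag_ideals up m =
     {I. I \<subseteq> {..m} \<and>
         (\<forall>i<m. if up i then Suc i \<in> I \<longrightarrow> i \<in> I else i \<in> I \<longrightarrow> Suc i \<in> I)}"

definition end_ideals :: "(nat \<Rightarrow> bool) \<Rightarrow> nat \<Rightarrow> bool \<Rightarrow> bool \<Rightarrow> nat set set" where
  "end_ideals up m s t = {I \<in> zigzag_ideals up m. (0 \<in> I \<longleftrightarrow> s) \<and> (m \<in> I \<longleftrightarrow> t)}"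

text \<open>Two weights, so that \<open>(1, q)\<close> records the size of an ideal and
  \<open>(q, 1)\<close> the size of its complement among the \<open>m + 1\<close> vertices.\<close>

definition weight :: "'a::comm_semiring_1 \<Rightarrow> 'a \<Rightarrow> nat \<Rightarrow> nat set \<Rightarrow> 'a" where
  "weight a b m I = (\<Prod>i\<le>m. if i \<in> I then b else a)"

text \<open>For fixed \<open>m\<close> a 2 x 2 matrix with row \<open>s\<close> and column
  \<open>t\<close>, \<open>False\<close> first: the product D E_0 D E_1 ... E_(m-1) D with D =
  diag(a, b), where E_i is [[1,0],[1,1]] for an ascending and [[1,1],[0,1]] for a descending
  edge.\<close>

definition transfer ::
  "'a::comm_semiring_1 \<Rightarrow> 'a \<Rightarrow> (nat \<Rightarrow> bool) \<Rightarrow> nat \<Rightarrow> bool \<Rightarrow> bool \<Rightarrow> 'a" where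
  "transfer a b up m s t = (\<Sum>I\<in>end_ideals up m s t. weight a b m I)"

lemma zigzag_ideals_subset: "I \<in> zigzag_ideals up m \<Longrightarrow> I \<subseteq> {..m}"
  by (simp add: zigzag_ideals_def)

lemma finite_zigzag_ideals [simp]: "finite (zigzag_ideals up m)"
  by (rule finite_subset[of _ "Pow {..m}"]) (auto dest: zigzag_ideals_subset)

lemma finite_end_ideals [simp]: "finite (end_ideals up m s t)"
  by (simp add: end_ideals_def)

lemma Suc_notin_zigzag_ideal: "I \<in> zigzag_ideals up m \<Longrightarrow> Suc m \<notin> I"
  using zigzag_ideals_subset by fastforce

text \<open>Only the edge between \<open>m\<close> and \<open>Suc m\<close> is new, and its
  condition involves no vertex before \<open>m\<close>. This locality gives the matrix
  recursion.\<close>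

lemma zigzag_ideals_Suc:
  assumes "I \<subseteq> {..m}"
  shows "I \<in> zigzag_ideals up (Suc m) \<longleftrightarrow> I \<in> zigzag_ideals up m \<and> (up m \<or> m \<notin> I)"
    and "insert (Suc m) I \<in> zigzag_ideals up (Suc m) \<longleftrightarrow>
      I \<in> zigzag_ideals up m \<and> (up m \<longrightarrow> m \<in> I)"
proof -
  have sub: "I \<subseteq> {..Suc m}" "insert (Suc m) I \<subseteq> {..Suc m}" and notin: "Suc m \<notin> I"
    using assms by auto
  show "I \<in> zigzag_ideals up (Suc m) \<longleftrightarrow> I \<in> zigzag_ideals up m \<and> (up m \<or> m \<notin> I)"
    using assms sub(1) notin by (simp add: zigzag_ideals_def All_less_Suc) blast
  have "i \<in> insert (Suc m) I \<longleftrightarrow> i \<in> I" "Suc i \<in> insert (Suc m) I \<longleftrightarrow> Suc i \<in> I"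
    if "i < m" for i
    using that by auto
  then show "insert (Suc m) I \<in> zigzag_ideals up (Suc m) \<longleftrightarrow>
      I \<in> zigzag_ideals up m \<and> (up m \<longrightarrow> m \<in> I)"
    using assms sub(2) by (simp add: zigzag_ideals_def All_less_Suc cong: conj_cong) blast
qed

lemma end_ideals_Suc_False:
  "end_ideals up (Suc m) s False =
     end_ideals up m s False \<union> (if up m then end_ideals up m s True else {})"
    (is "?L = ?R")
proof (rule set_eqI)
  fix I
  \<comment> \<open>Members of either side avoid \<open>Suc m\<close>, so any other \<open>I\<close>
    lies in neither.\<close>
  consider "I \<subseteq> {..m}" | "I \<notin> ?L" "I \<notin> ?R"
    unfolding end_ideals_def zigzag_ideals_def atMost_Suc by (cases "up m"; simp; blast)
  then show "I \<in> ?L \<longleftrightarrow> I \<in> ?R"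
  proof cases
    case 1
    then have "Suc m \<notin> I" by auto
    with zigzag_ideals_Suc(1)[OF 1] show ?thesis by (simp add: end_ideals_def) blast
  qed blast
qed

lemma insert_Suc_in_end_ideals:
  assumes "I \<subseteq> {..m}"
  shows "insert (Suc m) I \<in> end_ideals up (Suc m) s True \<longleftrightarrow>
    I \<in> end_ideals up m s True \<union> (if up m then {} else end_ideals up m s False)"
  using zigzag_ideals_Suc(2)[OF assms] by (simp add: end_ideals_def) blast

lemma end_ideals_Suc_True:
  "end_ideals up (Suc m) s True =
     insert (Suc m) ` (end_ideals up m s True \<union> (if up m then {} else end_ideals up m s False))"
    (is "?L = insert _ ` ?R")
proof
  show "?L \<subseteq> insert (Suc m) ` ?R"
  proof
    fix J assume J: "J \<in> ?L"
    then have eq: "J = insert (Suc m) (J - {Suc m})" and sub: "J - {Suc m} \<subseteq> {..m}"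
      by (auto simp: end_ideals_def zigzag_ideals_def atMost_Suc)
    from J eq have "J - {Suc m} \<in> ?R"
      using insert_Suc_in_end_ideals[OF sub] by metis
    with eq show "J \<in> insert (Suc m) ` ?R" by blast
  qed
  have "I \<subseteq> {..m}" if "I \<in> ?R" for I
    using that by (auto simp: end_ideals_def zigzag_ideals_def split: if_splits)
  then show "insert (Suc m) ` ?R \<subseteq> ?L"
    using insert_Suc_in_end_ideals by blast
qed

lemma weight_Suc:
  assumes "I \<subseteq> {..m}"
  shows "weight a b (Suc m) I = a * weight a b m I"
    and "weight a b (Suc m) (insert (Suc m) I) = b * weight a b m I"
proof -
  have "Suc m \<notin> I" using assms by auto
  then show "weight a b (Suc m) I = a * weight a b m I"
    by (simp add: weight_def mult.commute)
  have "weight a b m (insert (Suc m) I) = weight a b m I"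
    by (auto simp: weight_def intro!: prod.cong)
  then show "weight a b (Suc m) (insert (Suc m) I) = b * weight a b m I"
    by (simp add: weight_def mult.commute)
qed

lemma transfer_0:
  "transfer a b up 0 s t = (if s = t then if s then b else a else 0)"
proof -
  have "end_ideals up 0 s t = (if s = t then {if s then {0} else {}} else {})"
    by (auto simp: end_ideals_def zigzag_ideals_def)
  then show ?thesis by (simp add: transfer_def weight_def)
qed

lemma end_ideals_disjoint: "end_ideals up m s True \<inter> end_ideals up m s False = {}"
  by (auto simp: end_ideals_def)

lemma transfer_Suc_False:
  "transfer a b up (Suc m) s False =
     a * (transfer a b up m s False + (if up m then transfer a b up m s True else 0))"
proof -
  have *: "(\<Sum>I\<in>end_ideals up m s t. weight a b (Suc m) I) = a * transfer a b up m s t" for t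
    unfolding transfer_def sum_distrib_left
    by (intro sum.cong refl weight_Suc) (auto simp: end_ideals_def dest: zigzag_ideals_subset)
  have "transfer a b up (Suc m) s False =
      (\<Sum>I\<in>end_ideals up m s False. weight a b (Suc m) I) +
      (\<Sum>I\<in>(if up m then end_ideals up m s True else {}). weight a b (Suc m) I)"
    unfolding transfer_def end_ideals_Suc_False
    using end_ideals_disjoint[of up m s] by (intro sum.union_disjoint) auto
  then show ?thesis by (simp add: * distrib_left)
qed

lemma transfer_Suc_True:
  "transfer a b up (Suc m) s True =
     b * (transfer a b up m s True + (if up m then 0 else transfer a b up m s False))"
proof -
  let ?R = "end_ideals up m s True \<union> (if up m then {} else end_ideals up m s False)"
  have *: "(\<Sum>I\<in>end_ideals up m s t. weight a b (Suc m) (insert (Suc m) I)) =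
      b * transfer a b up m s t" for t
    unfolding transfer_def sum_distrib_left
    by (intro sum.cong refl weight_Suc) (auto simp: end_ideals_def dest: zigzag_ideals_subset)
  have "Suc m \<notin> I" if "I \<in> ?R" for I
    using that by (auto simp: end_ideals_def Suc_notin_zigzag_ideal split: if_splits)
  then have "inj_on (insert (Suc m)) ?R"
    by (intro inj_onI) (metis insert_ident)
  then have "transfer a b up (Suc m) s True =
      (\<Sum>I\<in>?R. weight a b (Suc m) (insert (Suc m) I))"
    unfolding transfer_def end_ideals_Suc_True by (simp add: sum.reindex)
  also have "\<dots> = (\<Sum>I\<in>end_ideals up m s True. weight a b (Suc m) (insert (Suc m) I)) +
      (\<Sum>I\<in>(if up m then {} else end_ideals up m s False). weight a b (Suc m) (insert (Suc m) I))"
    using end_ideals_disjoint[of up m s] by (intro sum.union_disjoint) auto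
  finally show ?thesis by (simp add: * distrib_left)
qed

text \<open>
  Entrywise, this is $P W D' = W' D P$ with the first column divided by $q$, where $W$ and $W'$
  are the transfer matrices for the weights $(1,q)$ and $(q,1)$, $D = \mathrm{diag}(1,q)$ and
  $D' = \mathrm{diag}(q,1)$.
\<close>

lemma transfer_intertwined:
  fixes q :: "'a::comm_ring_1"
  defines "w \<equiv> transfer 1 q" and "w' \<equiv> transfer q 1"
  shows "q * w up m False False + (q - 1) * w up m True False =
           w' up m False False + (1 - q) * w' up m False True"
    and "q * w up m False True + (q - 1) * w up m True True =
           (q - 1) * w' up m False False + q * w' up m False True"
    and "(1 - q) * w up m False False + w up m True False =
           w' up m True False + (1 - q) * w' up m True True"
    and "(1 - q) * w up m False True + w up m True True =
           (q - 1) * w' up m True False + q * w' up m True True"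
proof (induction m)
  case 0
  { case 1 show ?case by (simp add: w_def w'_def transfer_0) }
  { case 2 show ?case by (simp add: w_def w'_def transfer_0) }
  { case 3 show ?case by (simp add: w_def w'_def transfer_0) }
  { case 4 show ?case by (simp add: w_def w'_def transfer_0) }
next
  case (Suc m)
  note rec = w_def w'_def transfer_Suc_False transfer_Suc_True
  note IH = Suc.IH[unfolded w_def w'_def]
  \<comment> \<open>A new edge rescales one column and replaces the other by a multiple of the sum
    of both. So each case needs either its own hypothesis or the sum of the two for the same row of
    P; in the \<open>True\<close> column both are multiplied by the weight q.\<close>
  note IH12 = arg_cong2[of _ _ _ _ "(+)", OF IH(1,2)]
  note IH34 = arg_cong2[of _ _ _ _ "(+)", OF IH(3,4)]
  { case 1 show ?case
      using IH(1) IH12 by (cases "up m") (simp_all add: rec algebra_simps) }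
  { case 2 show ?case
      using arg_cong[OF IH(2), of "(*) q"] arg_cong[OF IH12, of "(*) q"]
      by (cases "up m") (simp_all add: rec algebra_simps) }
  { case 3 show ?case
      using IH(3) IH34 by (cases "up m") (simp_all add: rec algebra_simps) }
  { case 4 show ?case
      using arg_cong[OF IH(4), of "(*) q"] arg_cong[OF IH34, of "(*) q"]
      by (cases "up m") (simp_all add: rec algebra_simps) }
qed

section \<open>Rank symmetry of circular fences\<close>

definition circular_ideals :: "(nat \<Rightarrow> bool) \<Rightarrow> nat \<Rightarrow> nat set set" where
  "circular_ideals up m = {I \<in> zigzag_ideals up m. m \<in> I \<longrightarrow> 0 \<in> I}"

lemma finite_circular_ideals [simp]: "finite (circular_ideals up m)"
  by (simp add: circular_ideals_def)

text \<open>The closing edge, read from \<open>m\<close> back to \<open>0\<close>, descends and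
  excludes just one end pattern. The right-hand side is the trace of the \<open>transfer\<close>
  matrix times [[1,1],[0,1]].\<close>

lemma sum_weight_circular_ideals:
  "(\<Sum>I\<in>circular_ideals up m. weight a b m I) =
     transfer a b up m False False + transfer a b up m True False + transfer a b up m True True"
proof -
  have "circular_ideals up m =
      (end_ideals up m False False \<union> end_ideals up m True False) \<union> end_ideals up m True True"
    by (auto simp: circular_ideals_def end_ideals_def)
  moreover have "end_ideals up m False False \<inter> end_ideals up m True False = {}"
    "(end_ideals up m False False \<union> end_ideals up m True False) \<inter> end_ideals up m True True = {}"
    by (auto simp: end_ideals_def)
  ultimately show ?thesis
    by (simp add: transfer_def sum.union_disjoint)
qed

lemma circular_weight_symmetric:
  fixes q :: "'a::idom"
  assumes "q\<^sup>2 - q + 1 \<noteq> 0"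
  shows "(\<Sum>I\<in>circular_ideals up m. weight 1 q m I) = (\<Sum>I\<in>circular_ideals up m. weight q 1 m I)"
    (is "?l = ?r")
proof -
  \<comment> \<open>P need not be invertible over the ring, so the traces are compared after
    multiplication by det P, which is cancelled afterwards.\<close>
  have "(q\<^sup>2 - q + 1) * ?l = (q\<^sup>2 - q + 1) * ?r"
    unfolding sum_weight_circular_ideals using transfer_intertwined[of q up m] by algebra
  with assms show ?thesis by simp
qed

section \<open>Generating polynomials and comparison of coefficients\<close>

lemma weight_eq_power:
  assumes "I \<subseteq> {..m}"
  shows "weight a b m I = b ^ card I * a ^ (Suc m - card I)"
proof -
  have "weight a b m I = b ^ card ({..m} \<inter> I) * a ^ card ({..m} \<inter> - I)"
    unfolding weight_def by (subst prod.If_cases) (auto simp: Collect_mem_eq Compl_eq)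
  moreover have "{..m} \<inter> I = I" "{..m} \<inter> - I = {..m} - I"
    using assms by auto
  moreover have "card ({..m} - I) = Suc m - card I"
    using assms finite_subset by (subst card_Diff_subset) auto
  ultimately show ?thesis by simp
qed

lemma coeff_sum_monom_card:
  assumes "finite A"
  shows "coeff (\<Sum>x\<in>A. monom (1::int) (f x)) k = int (card {x \<in> A. f x = k})"
  using assms by (simp add: coeff_sum sum.If_cases Int_def)

text \<open>With q the indeterminate over the integers, the two weight sums are the generating
  polynomials for the sizes of the ideals and of their complements; equal polynomials have equal
  coefficients.\<close>

theorem circular_rank_symmetric:
  "card {I \<in> circular_ideals up m. card I = k} =
   card {I \<in> circular_ideals up m. Suc m - card I = k}"
proof -
  let ?q = "monom (1::int) 1"
  have sub: "I \<subseteq> {..m}" if "I \<in> circular_ideals up m" for I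
    using that by (auto simp: circular_ideals_def zigzag_ideals_def)
  have "coeff (?q\<^sup>2 - ?q + 1) 0 \<noteq> 0"
    by (simp add: power2_eq_square mult_monom)
  then have "?q\<^sup>2 - ?q + 1 \<noteq> 0" by (metis coeff_0)
  from circular_weight_symmetric[OF this, where up = up and m = m]
  have "(\<Sum>I\<in>circular_ideals up m. monom (1::int) (card I)) =
      (\<Sum>I\<in>circular_ideals up m. monom 1 (Suc m - card I))"
    by (simp add: weight_eq_power sub monom_power cong: sum.cong)
  from arg_cong[OF this, of "\<lambda>p. coeff p k"] show ?thesis
    by (simp add: coeff_sum_monom_card)
qed

section \<open>Fences as zigzags\<close>

lemma seg_cover_exists:
  assumes "v < sum_list \<beta>"
  shows "\<exists>i j. i < length \<beta> \<and> j < \<beta> ! i \<and> v = seg_start \<beta> i + j"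
  using assms
\<comment> \<open>Appending a segment on the right leaves the starts of the earlier segments
  unchanged.\<close>
proof (induction \<beta> rule: rev_induct)
  case (snoc b \<beta>)
  show ?case
  proof (cases "v < sum_list \<beta>")
    case True
    with snoc.IH obtain i j where "i < length \<beta>" "j < \<beta> ! i" "v = seg_start \<beta> i + j" by blast
    then show ?thesis
      by (intro exI[of _ i] exI[of _ j]) (simp add: nth_append seg_start_def)
  next
    case False
    with snoc.prems show ?thesis
      by (intro exI[of _ "length \<beta>"] exI[of _ "v - sum_list \<beta>"]) (simp add: seg_start_def)
  qed
qed simp

text \<open>This justifies one Boolean per edge: an edge that does not ascend must descend.\<close>

lemma fence_cover_total:
  assumes "v < sum_list \<beta>"
  shows "(v, Suc v) \<in> fence_cover \<beta> \<or> (Suc v, v) \<in> fence_cover \<beta>"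
proof -
  from seg_cover_exists[OF assms] obtain i j where
    "i < length \<beta>" "j < \<beta> ! i" "v = seg_start \<beta> i + j" by blast
  then show ?thesis unfolding fence_cover_def by (cases "even i") auto
qed

lemma fence_ideals_iff_cover_closed:
  "I \<in> fence_ideals \<beta> \<longleftrightarrow> I \<subseteq> fence \<beta> \<and> (\<forall>x y. (x, y) \<in> fence_cover \<beta> \<longrightarrow> y \<in> I \<longrightarrow> x \<in> I)"
    (is "_ \<longleftrightarrow> ?r")
proof
  assume "I \<in> fence_ideals \<beta>"
  then show ?r
    using fence_cover_in_fence[of _ _ \<beta>]
    unfolding fence_ideals_def fence_le_def by blast
next
  assume r: ?r
  have "x \<in> I" if "(x, y) \<in> (fence_cover \<beta>)\<^sup>*" "y \<in> I" for x y
    using that by (induction rule: converse_rtrancl_induct) (use r in blast)+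
  with r show "I \<in> fence_ideals \<beta>"
    unfolding fence_ideals_def fence_le_def by blast
qed

lemma fence_ideals_eq_zigzag:
  "fence_ideals \<beta> = zigzag_ideals (\<lambda>v. (v, Suc v) \<in> fence_cover \<beta>) (sum_list \<beta>)"
proof -
  have "(\<forall>x y. (x, y) \<in> fence_cover \<beta> \<longrightarrow> y \<in> I \<longrightarrow> x \<in> I) \<longleftrightarrow>
      (\<forall>i<sum_list \<beta>. if (i, Suc i) \<in> fence_cover \<beta> then Suc i \<in> I \<longrightarrow> i \<in> I
                     else i \<in> I \<longrightarrow> Suc i \<in> I)" (is "?l \<longleftrightarrow> ?r") for I
  proof
    assume ?l
    then show ?r using fence_cover_total by (metis (full_types))
  next
    assume r: ?r
    show ?l
    proof (intro allI impI)
      fix x y assume xy: "(x, y) \<in> fence_cover \<beta>" "y \<in> I"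
      from fence_cover_in_fence[OF xy(1)] have "x \<le> sum_list \<beta>" "y \<le> sum_list \<beta>"
        by (auto simp: fence_def)
      with fence_cover_adjacent[OF xy(1)] fence_cover_asym[OF xy(1)] xy r
      show "x \<in> I" by (auto simp: Suc_le_eq)
    qed
  qed
  then show ?thesis
    by (auto simp: fence_ideals_iff_cover_closed zigzag_ideals_def fence_def atLeast0AtMost)
qed

section \<open>The two end segments and ideals of extreme size\<close>

lemma first_segment_up:
  assumes "\<beta> \<noteq> []" "v < hd \<beta>"
  shows "(v, Suc v) \<in> fence_cover \<beta>"
proof -
  have "\<exists>i j. v = seg_start \<beta> i + j \<and> i < length \<beta> \<and> j < \<beta> ! i \<and> even i"
    using assms by (intro exI[of _ 0] exI[of _ v]) (simp add: seg_start_def hd_conv_nth)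
  then show ?thesis unfolding fence_cover_def by auto
qed

lemma sum_list_butlast_last:
  fixes \<beta> :: "nat list"
  shows "\<beta> \<noteq> [] \<Longrightarrow> sum_list \<beta> = sum_list (butlast \<beta>) + last \<beta>"
  by (metis append_butlast_last_id sum_list_append sum_list.Cons sum_list.Nil add_0_right)

text \<open>Odd length makes the 0-based index \<open>length \<beta> - 1\<close> of the last segment
  even, hence the segment ascends. The last hypothesis puts \<open>v\<close> at or after its
  start.\<close>

lemma last_segment_up:
  assumes "odd (length \<beta>)" "v < sum_list \<beta>" "sum_list \<beta> \<le> v + last \<beta>"
  shows "(v, Suc v) \<in> fence_cover \<beta>"
proof -
  have "\<beta> \<noteq> []" using assms(1) by auto
  then have "\<exists>i j. v = seg_start \<beta> i + j \<and> i < length \<beta> \<and> j < \<beta> ! i \<and> even i"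
    using assms sum_list_butlast_last[of \<beta>]
    by (intro exI[of _ "length \<beta> - 1"] exI[of _ "v - sum_list (butlast \<beta>)"])
      (simp add: seg_start_def last_conv_nth butlast_conv_take)
  then show ?thesis unfolding fence_cover_def by auto
qed

text \<open>The vertex \<open>sum_list \<beta>\<close> is the top of the last segment, so an ideal
  containing it contains that whole chain of \<open>last \<beta> + 1\<close> elements.\<close>

lemma fence_ideal_card_gt_last:
  assumes "odd (length \<beta>)" "I \<in> fence_ideals \<beta>" "sum_list \<beta> \<in> I"
  shows "last \<beta> < card I"
proof -
  let ?N = "sum_list \<beta>"
  have "\<beta> \<noteq> []" using assms(1) by auto
  then have le: "last \<beta> \<le> ?N" using sum_list_butlast_last by simp
  have "?N - j \<in> I" if "j \<le> last \<beta>" for j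
    using that
  proof (induction j)
    case (Suc j)
    then have "(?N - Suc j, Suc (?N - Suc j)) \<in> fence_cover \<beta>"
      using assms(1) le by (intro last_segment_up) auto
    moreover have "Suc (?N - Suc j) = ?N - j" using Suc.prems le by simp
    ultimately show ?case
      using Suc assms(2) by (auto simp: fence_ideals_iff_cover_closed)
  qed (use assms in simp)
  then have "(\<lambda>j. ?N - j) ` {..last \<beta>} \<subseteq> I" by auto
  moreover have "inj_on (\<lambda>j. ?N - j) {..last \<beta>}"
    using le by (intro inj_onI) auto
  moreover have "finite I"
    using assms(2) finite_subset by (auto simp: fence_ideals_def fence_def)
  ultimately have "card {..last \<beta>} \<le> card I" by (metis card_image card_mono)
  then show ?thesis by simp
qed

text \<open>Dually, vertex \<open>0\<close> is the bottom of the first segment: if it is missing, so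
  are all \<open>hd \<beta> + 1\<close> elements of that chain.\<close>

lemma fence_ideal_card_add_hd_le:
  assumes "\<beta> \<noteq> []" "I \<in> fence_ideals \<beta>" "0 \<notin> I"
  shows "card I + hd \<beta> \<le> sum_list \<beta>"
proof -
  have "hd \<beta> \<le> sum_list \<beta>" using assms(1) by (cases \<beta>) auto
  have "v \<notin> I" if "v \<le> hd \<beta>" for v
    using that
  proof (induction v)
    case (Suc v)
    then show ?case
      using assms first_segment_up[of \<beta> v] by (auto simp: fence_ideals_iff_cover_closed)
  qed (use assms in simp)
  then have "I \<subseteq> {hd \<beta><..sum_list \<beta>}"
    using assms(2) by (force simp: fence_ideals_def fence_def not_le[symmetric])
  then have "card I \<le> card {hd \<beta><..sum_list \<beta>}" by (intro card_mono) auto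
  with \<open>hd \<beta> \<le> sum_list \<beta>\<close> show ?thesis by simp
qed

theorem theorem1p3:
  fixes \<beta> :: "nat list" and n k :: nat
  assumes "composition \<beta>"
    and "odd (length \<beta>)"
    and "n = card (fence \<beta>)"
    and "k \<le> min (hd \<beta>) (last \<beta>)"
  shows "rank_number \<beta> k = rank_number \<beta> (n - k)"
proof -
  define N where "N = sum_list \<beta>"
  define C where "C = circular_ideals (\<lambda>v. (v, Suc v) \<in> fence_cover \<beta>) N"
  have C: "C = {I \<in> fence_ideals \<beta>. N \<in> I \<longrightarrow> 0 \<in> I}"
    by (simp add: C_def circular_ideals_def fence_ideals_eq_zigzag N_def)
  have ne: "\<beta> \<noteq> []" using assms(2) by auto
  then have "hd \<beta> \<le> N" unfolding N_def by (cases \<beta>) auto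
  with assms(4) have kN: "k \<le> N" by simp
  have n: "n = Suc N" using assms(3) by (simp add: card_fence N_def)
  have card_le: "card I \<le> n" if "I \<in> fence_ideals \<beta>" for I
    using that card_mono[of "fence \<beta>" I] assms(3) by (simp add: fence_ideals_def fence_def)
  \<comment> \<open>At most \<open>last \<beta>\<close> elements: the top vertex \<open>N\<close> is
    absent, so the closing condition holds vacuously.\<close>
  have "{I \<in> fence_ideals \<beta>. card I = k} = {I \<in> C. card I = k}"
    using assms(4) fence_ideal_card_gt_last[OF assms(2)] unfolding C N_def by fastforce
  \<comment> \<open>At most \<open>hd \<beta>\<close> elements are missing, so \<open>0\<close> is
    present and the closing condition holds. The bounds \<open>card_le\<close> and \<open>kN\<close>
    keep the truncated subtractions exact.\<close>
  moreover have "{I \<in> fence_ideals \<beta>. card I = n - k} = {I \<in> C. Suc N - card I = k}"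
    using assms(4) fence_ideal_card_add_hd_le[OF ne] card_le kN n
    unfolding C N_def[symmetric] by fastforce
  moreover have "card {I \<in> C. card I = k} = card {I \<in> C. Suc N - card I = k}"
    unfolding C_def by (rule circular_rank_symmetric)
  ultimately show ?thesis by (simp add: rank_number_def)
qed

end
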